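(* Let $\mathbf{L},\mathbf{M}\in\mathbb{H}^{n}$ be such that $\mathbf{M}\succeq\mathbf{L}$, and let $\mathcal{X}\subseteq\mathbb{C}^{n\times m}$. The problem $$\underset{\mathbf{X}\in\mathcal{X}}{\text{minimize}}\ \ \mathrm{tr}\left(\mathbf{X}^{\mathsf{H}}\mathbf{L}\mathbf{X}\right)$$ is equivalent to the problem $$\underset{\mathbf{X}\in\mathcal{X},\,\mathbf{Z}\in\mathcal{X}}{\text{minimize}}\ \ \mathrm{tr}\Bigl(\mathbf{X}^{\mathsf{H}}\mathbf{M}\mathbf{X}+2\mathrm{Re}(\mathbf{X}^{\mathsf{H}}(\mathbf{L}-\mathbf{M})\mathbf{Z})+\mathbf{Z}^{\mathsf{H}}(\mathbf{M}-\mathbf{L})\mathbf{Z}\Bigr),$$ in the sense that they attain the identical optimal solution with the identical optimal objective value: the two optimal values coincide, and $\mathbf{X}^\star$ is optimal for the first problem if and only if $(\mathbf{X}^\star,\mathbf{Z}^\star)$ is optimal for the second for some $\mathbf{Z}^\star\in\mathcal{X}$.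
   Context: $\mathbb{H}^n$ is the set of $n\times n$ complex Hermitian matrices; $\mathbf{M}\succeq\mathbf{L}$ means $\mathbf{M}-\mathbf{L}$ is positive semidefinite; $(\cdot)^{\mathsf{H}}$ is the conjugate transpose; for a square matrix $\mathbf{A}$, $2\mathrm{Re}(\mathbf{A})=\mathbf{A}+\mathbf{A}^{\mathsf{H}}$, so $\mathrm{tr}(2\mathrm{Re}(\mathbf{A}))=2\mathrm{Re}(\mathrm{tr}(\mathbf{A}))$. *)

theory Defs
  imports "HOL-Analysis.Analysis"
begin

definition ctranspose :: "complex ^ 'm ^ 'n \<Rightarrow> complex ^ 'n ^ 'm"  (\<open>(_\<^sup>H)\<close> [1000] 999)
  where "A\<^sup>H = (\<chi> i j. cnj (A $ j $ i))"

definition hermitian :: "complex ^ 'n ^ 'n \<Rightarrow> bool"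
  where "hermitian A \<longleftrightarrow> A\<^sup>H = A"

text \<open>For a Hermitian matrix the quadratic form \<open>v\<^sup>H A v\<close> is real, so taking its real part
  below only changes the type.\<close>

definition psd :: "complex ^ 'n ^ 'n \<Rightarrow> bool"
  where "psd A \<longleftrightarrow> hermitian A \<and> (\<forall>v. 0 \<le> Re (\<Sum>i\<in>UNIV. cnj (v $ i) * (A *v v) $ i))"

definition loewner_ge :: "complex ^ 'n ^ 'n \<Rightarrow> complex ^ 'n ^ 'n \<Rightarrow> bool"  (infix \<open>\<succeq>\<close> 50)
  where "M \<succeq> L \<longleftrightarrow> psd (M - L)"

text \<open>The matrix \<open>2 Re(A)\<close>; this is \<open>A + A\<^sup>H\<close>, not twice the entrywise real part.\<close>

definition twoRe :: "complex ^ 'n ^ 'n \<Rightarrow> complex ^ 'n ^ 'n"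
  where "twoRe A = A + A\<^sup>H"

text \<open>The traces below are real for Hermitian \<open>L\<close> and \<open>M\<close> (lemmas \<open>trace_objective_real\<close> and
  \<open>trace_surrogate_real\<close>), so \<open>Re\<close> only turns them into elements of the ordered type
  \<^typ>\<open>real\<close>.\<close>

definition objective :: "complex ^ 'n ^ 'n \<Rightarrow> complex ^ 'm ^ 'n \<Rightarrow> real"
  where "objective L X = Re (trace (X\<^sup>H ** L ** X))"

definition surrogate ::
  "complex ^ 'n ^ 'n \<Rightarrow> complex ^ 'n ^ 'n \<Rightarrow> complex ^ 'm ^ 'n \<Rightarrow> complex ^ 'm ^ 'n \<Rightarrow> real"
  where "surrogate L M X Z =
    Re (trace (X\<^sup>H ** M ** X + twoRe (X\<^sup>H ** (L - M) ** Z) + Z\<^sup>H ** (M - L) ** Z))"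

text \<open>The infimum is taken in the extended reals, so that it also exists when the problem is
  infeasible (value \<open>\<infinity>\<close>) or unbounded below (value \<open>-\<infinity>\<close>).\<close>

definition optimal_value :: "('a \<Rightarrow> real) \<Rightarrow> 'a set \<Rightarrow> ereal"
  where "optimal_value f S = (INF x\<in>S. ereal (f x))"

lemma ctranspose_mult: "(A ** B)\<^sup>H = B\<^sup>H ** A\<^sup>H"
  by (simp add: ctranspose_def matrix_matrix_mult_def vec_eq_iff mult.commute)

lemma ctranspose_ctranspose [simp]: "(A\<^sup>H)\<^sup>H = A"
  by (simp add: ctranspose_def vec_eq_iff)

lemma ctranspose_add: "(A + B)\<^sup>H = A\<^sup>H + B\<^sup>H"
  by (simp add: ctranspose_def vec_eq_iff)

lemma ctranspose_diff: "(A - B)\<^sup>H = A\<^sup>H - B\<^sup>H"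
  by (simp add: ctranspose_def vec_eq_iff)

lemma trace_hermitian_real: "hermitian A \<Longrightarrow> trace A \<in> \<real>"
  unfolding trace_def hermitian_def ctranspose_def
  by (intro sum_in_Reals) (auto simp: vec_eq_iff Reals_cnj_iff)

lemma hermitian_congruence: "hermitian A \<Longrightarrow> hermitian (X\<^sup>H ** A ** X)"
  by (simp add: hermitian_def ctranspose_mult matrix_mul_assoc)

lemma trace_objective_real: "hermitian L \<Longrightarrow> trace (X\<^sup>H ** L ** X) \<in> \<real>"
  by (intro trace_hermitian_real hermitian_congruence)

lemma trace_surrogate_real:
  assumes "hermitian L" "hermitian M"
  shows "trace (X\<^sup>H ** M ** X + twoRe (X\<^sup>H ** (L - M) ** Z) + Z\<^sup>H ** (M - L) ** Z) \<in> \<real>"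
proof (rule trace_hermitian_real)
  have "hermitian (M - L)"
    using assms by (simp add: hermitian_def ctranspose_diff)
  then have "hermitian (X\<^sup>H ** M ** X)" "hermitian (Z\<^sup>H ** (M - L) ** Z)"
    using assms by (auto intro: hermitian_congruence)
  moreover have "hermitian (twoRe B)" for B :: "complex ^ 'k ^ 'k"
    by (simp add: hermitian_def twoRe_def ctranspose_add add.commute)
  ultimately show "hermitian (X\<^sup>H ** M ** X + twoRe (X\<^sup>H ** (L - M) ** Z) + Z\<^sup>H ** (M - L) ** Z)"
    by (simp add: hermitian_def ctranspose_add)
qed

end

theory Submission
  imports Defs
begin

text \<open>With \<open>P = M - L\<close>, the surrogate equals
  \<open>tr (X\<^sup>H L X) + tr ((X - Z)\<^sup>H P (X - Z))\<close>. The second term is nonnegative because \<open>P\<close> is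
  positive semidefinite, and it vanishes at \<open>Z = X\<close>. So the surrogate majorizes the objective
  and touches it on the diagonal, and minimizing over \<open>Z\<close> first recovers the objective.\<close>

lemma matrix_diff_ldistrib: "(A :: 'a::ring_1 ^ 'n ^ 'm) ** (B - C) = A ** B - A ** C"
  by (simp add: matrix_matrix_mult_def vec_eq_iff right_diff_distrib sum_subtractf)

lemma matrix_diff_rdistrib: "((A :: 'a::ring_1 ^ 'n ^ 'm) - B) ** C = A ** C - B ** C"
  by (simp add: matrix_matrix_mult_def vec_eq_iff left_diff_distrib sum_subtractf)

text \<open>The \<open>j\<close>-th diagonal entry of \<open>Y\<^sup>H ** P ** Y\<close> is the
  quadratic form of \<open>P\<close> at the \<open>j\<close>-th column of \<open>Y\<close>. This
  links traces to \<open>psd\<close>, which speaks of vectors.\<close>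

lemma trace_congruence_columns:
  "trace (Y\<^sup>H ** P ** Y) =
    (\<Sum>j\<in>UNIV. \<Sum>i\<in>UNIV. cnj (column j Y $ i) * (P *v column j Y) $ i)"
  unfolding matrix_mul_assoc[symmetric]
  by (simp add: trace_def matrix_matrix_mult_def ctranspose_def matrix_vector_mult_def column_def)

lemma psd_trace_congruence_nonneg:
  assumes "psd P"
  shows "0 \<le> Re (trace (Y\<^sup>H ** P ** Y))"
  unfolding trace_congruence_columns Re_sum[of _ UNIV]
  by (rule sum_nonneg) (use assms in \<open>simp only: psd_def flip: Re_sum\<close>)

text \<open>Completing the square in \<open>X - Z\<close>: the two cross terms of the square are
  exactly the two halves of \<open>twoRe\<close>.\<close>

lemma surrogate_eq:
  assumes "hermitian (M - L)"
  shows "surrogate L M X Z = objective L X + Re (trace ((X - Z)\<^sup>H ** (M - L) ** (X - Z)))"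
proof -
  \<comment> \<open>Self-adjointness turns the adjoint half of \<open>twoRe\<close> into the cross
    term with \<open>Z\<close> on the left.\<close>
  have "(L - M)\<^sup>H = L - M"
    using assms unfolding hermitian_def ctranspose_diff by (metis minus_diff_eq)
  then have "(X\<^sup>H ** (L - M) ** Z)\<^sup>H = Z\<^sup>H ** (L - M) ** X"
    by (simp add: ctranspose_mult matrix_mul_assoc)
  then show ?thesis
    by (simp add: surrogate_def objective_def twoRe_def ctranspose_diff matrix_diff_ldistrib
        matrix_diff_rdistrib trace_add trace_sub)
qed

context
  fixes f :: "'a \<Rightarrow> real" and g :: "'a \<Rightarrow> 'a \<Rightarrow> real"
  assumes majorant: "f x \<le> g x z"
    and diagonal: "g x x = f x"
begin

text \<open>Each pair \<open>(x, z)\<close> is bounded below by the value at \<open>x\<close>, and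
  each \<open>x\<close> is matched by the pair \<open>(x, x)\<close>. No matrix structure enters, so
  \<open>f\<close> and \<open>g\<close> are arbitrary.\<close>

lemma optimal_value_majorant:
  "optimal_value f S = optimal_value (\<lambda>(x, z). g x z) (S \<times> S)"
  unfolding optimal_value_def
proof (rule antisym)
  show "(INF x\<in>S. ereal (f x)) \<le> (INF p\<in>S \<times> S. ereal (case p of (x, z) \<Rightarrow> g x z))"
    using majorant by (intro INF_mono) force
  show "(INF p\<in>S \<times> S. ereal (case p of (x, z) \<Rightarrow> g x z)) \<le> (INF x\<in>S. ereal (f x))"
    by (intro INF_mono bexI[where x = "(x, x)" for x]) (auto simp: diagonal)
qed

lemma is_arg_min_majorant:
  "is_arg_min f (\<lambda>x. x \<in> S) x \<longleftrightarrow>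
    (\<exists>z\<in>S. is_arg_min (\<lambda>(x, z). g x z) (\<lambda>p. p \<in> S \<times> S) (x, z))"
proof
  assume "is_arg_min f (\<lambda>x. x \<in> S) x"
  then have x: "x \<in> S" "\<And>y. y \<in> S \<Longrightarrow> f x \<le> f y"
    by (auto simp: is_arg_min_linorder)
  \<comment> \<open>The witness is \<open>z = x\<close>:
    \<open>g x x = f x \<le> f y \<le> g y w\<close>.\<close>
  then have "is_arg_min (\<lambda>(x, z). g x z) (\<lambda>p. p \<in> S \<times> S) (x, x)"
    using order_trans[OF x(2) majorant] by (auto simp: is_arg_min_linorder diagonal)
  with x(1) show "\<exists>z\<in>S. is_arg_min (\<lambda>(x, z). g x z) (\<lambda>p. p \<in> S \<times> S) (x, z)" by blast
next
  assume "\<exists>z\<in>S. is_arg_min (\<lambda>(x, z). g x z) (\<lambda>p. p \<in> S \<times> S) (x, z)"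
  then obtain z where z: "x \<in> S" "\<And>y w. y \<in> S \<Longrightarrow> w \<in> S \<Longrightarrow> g x z \<le> g y w"
    by (auto simp: is_arg_min_linorder)
  \<comment> \<open>Here \<open>z\<close> may differ from \<open>x\<close>; comparing with the
    diagonal pair \<open>(y, y)\<close> gives
    \<open>f x \<le> g x z \<le> g y y = f y\<close>.\<close>
  have "f x \<le> f y" if "y \<in> S" for y
    using majorant[of x z] z(2)[OF that that] by (simp add: diagonal)
  with z(1) show "is_arg_min f (\<lambda>x. x \<in> S) x"
    by (auto simp: is_arg_min_linorder)
qed

end

theorem corollary19:
  fixes L M :: "complex ^ 'n ^ 'n"
    and \<X> :: "(complex ^ 'm ^ 'n) set"
  assumes "hermitian L" and "hermitian M" and "M \<succeq> L"
  shows "optimal_value (objective L) \<X> = optimal_value (\<lambda>(X, Z). surrogate L M X Z) (\<X> \<times> \<X>)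
    \<and> (\<forall>X. is_arg_min (objective L) (\<lambda>X. X \<in> \<X>) X \<longleftrightarrow>
          (\<exists>Z\<in>\<X>. is_arg_min (\<lambda>(X, Z). surrogate L M X Z) (\<lambda>p. p \<in> \<X> \<times> \<X>) (X, Z)))"
proof -
  have psd: "psd (M - L)"
    using assms(3) by (simp add: loewner_ge_def)
  then have eq: "surrogate L M X Z =
      objective L X + Re (trace ((X - Z)\<^sup>H ** (M - L) ** (X - Z)))" for X Z :: "complex ^ 'm ^ 'n"
    by (intro surrogate_eq) (simp add: psd_def)
  have majorant: "objective L X \<le> surrogate L M X Z" for X Z :: "complex ^ 'm ^ 'n"
    using psd_trace_congruence_nonneg[OF psd] by (simp add: eq)
  \<comment> \<open>The square vanishes since \<open>X - X = 0\<close>.\<close>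
  have diagonal: "surrogate L M X X = objective L X" for X :: "complex ^ 'm ^ 'n"
    by (simp add: eq trace_def matrix_matrix_mult_def)
  show ?thesis
    using optimal_value_majorant[of "objective L" "surrogate L M", OF majorant diagonal]
      is_arg_min_majorant[of "objective L" "surrogate L M", OF majorant diagonal] by blast
qed

end
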